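(* For $m\ge1$, let $J(m)$ be the number of overpartitions of $m$ in which no part is divisible by $3$. Let $L(m)$ be the number of overpartitions of $m$ with $n$ copies of $n$ such that (i) with parts in ascending lexicographic order, the weighted difference between each part and the preceding one is $\ge0$, and (ii) whenever a maximal block of two or more consecutive parts has all successive weighted differences equal to $0$, only the smallest part of that block (in lexicographic order) may be overlined. Then $J(m)=L(m)$.
   Context: An overpartition of $m$ is a partition of $m$ in which, for each part size, the first occurrence of that part may (or may not) be overlined. $M=\{n_j: 1\le j\le n\}$; a partition with $n$ copies of $n$ is a finite multiset of elements of $M$ whose values (first entries) sum to $m$; an overpartition with $n$ copies of $n$ is such a multiset in which, for each element $n_j$, at most one occurrence may be overlined. Lexicographic order: $m_i>n_j$ iff $m>n$, or $m=n$ and $i>j$. Weighted difference $((m_i-n_j))=m-n-i-j$. *)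

theory Defs
  imports Main "HOL-Library.Multiset" "HOL-Library.Product_Lexorder"
begin

text \<open>Overpartitions of m with no part divisible by 3.
  An overpartition is a multiset P of positive parts together with the set Ov of
  part sizes whose first occurrence is overlined (Ov a subset of the distinct parts).\<close>

definition J_set :: "nat \<Rightarrow> (nat multiset \<times> nat set) set" where
  "J_set m = {(P, Ov). (\<forall>p\<in>#P. 0 < p \<and> \<not> (3 dvd p)) \<and> sum_mset P = m
                      \<and> Ov \<subseteq> set_mset P}"

definition J :: "nat \<Rightarrow> nat" where
  "J m = card (J_set m)"

text \<open>A part n_j with n copies of n is encoded as the pair (n, j) with 1 <= j <= n.
  The linear order on pairs (Product_Lexorder) is the lexicographic order of the paper.\<close>

definition wdiff :: "nat \<times> nat \<Rightarrow> nat \<times> nat \<Rightarrow> int" where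
  "wdiff a b = int (fst a) - int (fst b) - int (snd a) - int (snd b)"

definition overl_at :: "(nat \<times> nat) list \<Rightarrow> (nat \<times> nat) set \<Rightarrow> nat \<Rightarrow> bool" where
  "overl_at xs Ov k \<longleftrightarrow> xs ! k \<in> Ov \<and> (k = 0 \<or> xs ! (k - 1) \<noteq> xs ! k)"

definition L_cond :: "(nat \<times> nat) list \<Rightarrow> (nat \<times> nat) set \<Rightarrow> bool" where
  "L_cond xs Ov \<longleftrightarrow>
     (\<forall>k. 0 < k \<and> k < length xs \<longrightarrow> wdiff (xs ! k) (xs ! (k - 1)) \<ge> 0) \<and>
     (\<forall>a b. a < b \<and> b < length xs
        \<and> (\<forall>k. a < k \<and> k \<le> b \<longrightarrow> wdiff (xs ! k) (xs ! (k - 1)) = 0)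
        \<and> (a = 0 \<or> wdiff (xs ! a) (xs ! (a - 1)) \<noteq> 0)
        \<and> (b + 1 = length xs \<or> wdiff (xs ! (b + 1)) (xs ! b) \<noteq> 0)
        \<longrightarrow> (\<forall>k. a < k \<and> k \<le> b \<longrightarrow> \<not> overl_at xs Ov k))"

definition L_set :: "nat \<Rightarrow> ((nat \<times> nat) multiset \<times> (nat \<times> nat) set) set" where
  "L_set m = {(P, Ov). (\<forall>p\<in>#P. 1 \<le> snd p \<and> snd p \<le> fst p)
                      \<and> sum_mset (image_mset fst P) = m
                      \<and> Ov \<subseteq> set_mset P
                      \<and> L_cond (sorted_list_of_multiset P) Ov}"

definition L :: "nat \<Rightarrow> nat" where
  "L m = card (L_set m)"

end

theory Submission
  imports Defs "HOL-Computational_Algebra.Formal_Power_Series" "HOL-Library.Nat_Bijection"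
begin

text \<open>
  Reading off the weighted differences and the subscripts of a partition counted by \<open>L\<close> gives
  \<open>\<Sum> L(m) q^m = \<Sum>\<^sub>r q^(r^2) (-1;q)\<^sub>r / ((q;q)\<^sub>r (q;q^2)\<^sub>r)\<close>.
  This sum is evaluated by Bailey's lemma with parameters \<open>-1\<close> and \<open>\<infinity>\<close>: the pair with
  \<open>\<beta>\<^sub>n = q^(n(n-1)/2) / ((q;q)\<^sub>n (q;q^2)\<^sub>n)\<close>, whose \<open>\<alpha>\<close> lives on even indices, turns it into
  \<open>(-q;q)\<^sub>\<infinity> / (q;q)\<^sub>\<infinity>\<close> times the theta series \<open>\<Sum> (-1)^r q^(3 r^2)\<close> over all integers \<open>r\<close>.
  The unit Bailey pair yields Gauss's product for that theta series in base \<open>q^3\<close>, and the quotient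
  is the product over the part sizes not divisible by \<open>3\<close>.  All limits are taken as
  congruences modulo \<open>q^(N+1)\<close>, and the finite identities are proved by telescoping certificates.
\<close>

section \<open>Bailey's lemma for formal power series\<close>

definition qp_neg :: "'a::field_char_0 fps \<Rightarrow> nat \<Rightarrow> 'a fps" where
  "qp_neg q n = (\<Prod>i=1..n. 1 + q ^ i)"

definition qp_m1 :: "'a::field_char_0 fps \<Rightarrow> nat \<Rightarrow> 'a fps" where
  "qp_m1 q n = (\<Prod>i<n. 1 + q ^ i)"

text \<open>The value \<open>0\<close> at negative arguments lets sums over Bailey pairs run over any long enough range.\<close>

definition qinv :: "'a::field_char_0 fps \<Rightarrow> int \<Rightarrow> 'a fps" where
  "qinv q k = (if k < 0 then 0 else inverse (\<Prod>i=1..nat k. 1 - q ^ i))"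

definition qinv_odd :: "'a::field_char_0 fps \<Rightarrow> nat \<Rightarrow> 'a fps" where
  "qinv_odd q n = inverse (\<Prod>i=1..n. 1 - q ^ (2 * i - 1))"

lemma qp_neg_simps [simp]: "qp_neg q 0 = 1" "qp_neg q (Suc n) = (1 + q ^ Suc n) * qp_neg q n"
  by (simp_all add: qp_neg_def mult.commute)

lemma qp_m1_simps [simp]: "qp_m1 q 0 = 1" "qp_m1 q (Suc n) = (1 + q ^ n) * qp_m1 q n"
  by (simp_all add: qp_m1_def mult.commute)

text \<open>Multiplying (-1;q)_n by 1 + q^n gives the product over i = 0, ..., n, whose factor at i
  = 0 is 2.\<close>

lemma qp_m1_eq: "(1 + q ^ n) * qp_m1 q n = 2 * qp_neg q n"
  by (induction n) (simp_all add: algebra_simps)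

lemma qinv_negative [simp]: "k < 0 \<Longrightarrow> qinv q k = 0"
  by (simp add: qinv_def)

lemma qinv_0 [simp]: "qinv q 0 = 1"
  by (simp add: qinv_def)

lemma qinv_odd_0 [simp]: "qinv_odd q 0 = 1"
  by (simp add: qinv_odd_def)

text \<open>With a = q^k, b = q^l, c = q^r this is what remains of the telescoping step of
  \<open>kernel_shifted\<close> once the common factor \<open>w\<close> is removed.\<close>

lemma kernel_ring_identity:
  fixes a b c q :: "'a::comm_ring_1"
  shows "(1 - a*b*q) * (1 - a*b*c*c*q) - (1 + a*b*c*q) * (1 - b*q)
       = - a*b*c*q * (1 + c*a) * (1 - b*q) + b*q * (1 - a) * (1 - a*c*c)"
  by (simp add: algebra_simps)

lemma qinv_rec: "qinv q (int (Suc k)) = inverse (1 - q ^ Suc k) * qinv q (int k)"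
  by (simp add: qinv_def fps_inverse_mult mult.commute del: of_nat_Suc power_Suc)

lemma qinv_odd_rec: "qinv_odd q (Suc n) = inverse (1 - q ^ (2 * n + 1)) * qinv_odd q n"
  by (simp add: qinv_odd_def fps_inverse_mult mult.commute)

section \<open>The finite summation behind Bailey's lemma\<close>

locale qbase =
  fixes q :: "'a::field_char_0 fps"
  assumes q0: "fps_nth q 0 = 0"
begin

abbreviation E where "E \<equiv> qinv q"

lemma one_minus_nth_0: "0 < i \<Longrightarrow> fps_nth (1 - q ^ i) 0 = 1"
  using q0 by (simp add: fps_power_zeroth)

lemma one_minus_nz: "0 < i \<Longrightarrow> 1 - q ^ i \<noteq> 0"
  using one_minus_nth_0[of i] by (metis fps_zero_nth zero_neq_one)

lemma inverse_one_minus: "0 < i \<Longrightarrow> (1 - q ^ i) * inverse (1 - q ^ i) = 1"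
  using one_minus_nth_0[of i] inverse_mult_eq_1[of "1 - q ^ i"] by (simp only: mult.commute) simp

lemma qinv_Suc: "E (int k) = (1 - q ^ Suc k) * E (int (Suc k))"
  unfolding qinv_rec mult.assoc[symmetric] by (subst inverse_one_minus) simp_all

lemma qinv_odd_Suc: "qinv_odd q n = (1 - q ^ (2 * n + 1)) * qinv_odd q (Suc n)"
  unfolding qinv_odd_rec mult.assoc[symmetric] by (subst inverse_one_minus) simp_all

text \<open>Up to the k = 0 term this is the q-Chu-Vandermonde sum with upper parameters q^(-M),
  -q^r and lower parameter q^(2r+1). Induction on \<open>M\<close> works because the summand
  satisfies the first-order recurrence of the right-hand side up to a difference in
  \<open>k\<close>, as in the Wilf-Zeilberger method.\<close>

lemma kernel_shifted:
  "(\<Sum>k\<le>M. qp_m1 q (r + k) * q ^ triangle (r + k) * E (int (M - k)) * E (int k) * E (int (k + 2 * r)))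
     * (1 + q ^ r) = 2 * qp_neg q (r + M) * q ^ triangle r * E (int M) * E (int (M + 2 * r))"
proof (induction M)
  case 0
  have "qp_m1 q r * q ^ triangle r * E (int (2 * r)) * (1 + q ^ r)
      = ((1 + q ^ r) * qp_m1 q r) * (q ^ triangle r * E (int (2 * r)))"
    by (simp only: mult_ac)
  then show ?case using qp_m1_eq[of q r] by (simp add: mult_ac)
next
  case (Suc M)
  define V where "V M k = qp_m1 q (r + k) * q ^ triangle (r + k) * E (int (M - k)) * E (int k) * E (int (k + 2 * r))"
    for M k
  \<comment> \<open>The telescoping certificate. The factors \<open>1 - q ^ k\<close> and
    \<open>1 - q ^ (k + 2 * r)\<close> lower the arguments of \<open>E\<close> by one, in a form
    that gives \<open>G 0 = 0\<close>.\<close>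
  define G where "G k = - (q ^ (Suc M - k) * qp_m1 q (r + k) * q ^ triangle (r + k) * E (int (Suc M - k))
      * ((1 - q ^ k) * E (int k)) * ((1 - q ^ (k + 2 * r)) * E (int (k + 2 * r))))" for k
  define c where "c = (1 - q ^ Suc M) * (1 - q ^ (Suc M + 2 * r))"
  have step: "c * V (Suc M) k - (1 + q ^ (r + Suc M)) * V M k = G (Suc k) - G k" if "k \<le> M" for k
  proof -
    obtain l where l: "M = k + l" using \<open>k \<le> M\<close> le_Suc_ex by blast
    \<comment> \<open>Both values of \<open>V\<close> and both values of \<open>G\<close> are
      polynomial multiples of this one term.\<close>
    define w where "w = qp_m1 q (r + k) * q ^ triangle (r + k) * E (int (Suc l)) * E (int k) * E (int (k + 2 * r))"
    have G1: "G (Suc k) = - (q ^ k * q ^ l * q ^ r * q * (1 + q ^ r * q ^ k) * (1 - q ^ l * q) * w)"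
      using qinv_Suc[of l] qinv_Suc[of k] qinv_Suc[of "k + 2 * r"]
      by (simp add: G_def l w_def power_add mult_ac del: of_nat_Suc)
    have r2: "q ^ (j + 2 * r) = q ^ j * q ^ r * q ^ r" for j
      by (simp add: power_add mult_2)
    have G0: "G k = - (q ^ l * q * (1 - q ^ k) * (1 - q ^ k * q ^ r * q ^ r) * w)"
      unfolding G_def r2 w_def by (simp add: l Suc_diff_le mult_ac del: of_nat_Suc)
    have V1: "V (Suc M) k = w"
      by (simp add: V_def l w_def Suc_diff_le mult_ac del: of_nat_Suc)
    have V0: "V M k = (1 - q ^ l * q) * w"
      using qinv_Suc[of l] by (simp add: V_def l w_def mult_ac del: of_nat_Suc)
    have "c * V (Suc M) k - (1 + q ^ (r + Suc M)) * V M k =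
      ((1 - q ^ k * q ^ l * q) * (1 - q ^ k * q ^ l * q ^ r * q ^ r * q)
        - (1 + q ^ k * q ^ l * q ^ r * q) * (1 - q ^ l * q)) * w"
      unfolding V0 V1 c_def r2 by (simp add: l power_add algebra_simps)
    also have "\<dots> = (- (q ^ k) * q ^ l * q ^ r * q * (1 + q ^ r * q ^ k) * (1 - q ^ l * q)
        + q ^ l * q * (1 - q ^ k) * (1 - q ^ k * q ^ r * q ^ r)) * w"
      unfolding kernel_ring_identity ..
    also have "\<dots> = G (Suc k) - G k"
      unfolding G0 G1 by (simp add: algebra_simps)
    finally show ?thesis .
  qed
  \<comment> \<open>The top index is kept out of the telescoping: in \<open>V M (Suc M)\<close> the
    subtraction would be truncated to 0 and leave a spurious term.\<close>
  have last: "c * V (Suc M) (Suc M) = - G (Suc M)"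
    by (simp add: c_def V_def G_def mult_ac del: of_nat_Suc)
  have "c * (\<Sum>k\<le>Suc M. V (Suc M) k) - (1 + q ^ (r + Suc M)) * (\<Sum>k\<le>M. V M k)
      = (\<Sum>k\<le>M. c * V (Suc M) k - (1 + q ^ (r + Suc M)) * V M k) - G (Suc M)"
    using last by (simp add: distrib_left sum_distrib_left sum_subtractf)
  also have "(\<Sum>k\<le>M. c * V (Suc M) k - (1 + q ^ (r + Suc M)) * V M k) = (\<Sum>k\<le>M. G (Suc k) - G k)"
    by (intro sum.cong refl step) simp
  also have "\<dots> = G (Suc M) - G 0"
    by (simp add: sum_lessThan_telescope flip: lessThan_Suc_atMost)
  also have "G 0 = 0" by (simp add: G_def)
  finally have "c * (\<Sum>k\<le>Suc M. V (Suc M) k) = (1 + q ^ (r + Suc M)) * (\<Sum>k\<le>M. V M k)"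
    by simp
  then have "c * ((\<Sum>k\<le>Suc M. V (Suc M) k) * (1 + q ^ r))
      = (1 + q ^ (r + Suc M)) * ((\<Sum>k\<le>M. V M k) * (1 + q ^ r))"
    unfolding mult.assoc[symmetric] by (rule arg_cong)
  also have "\<dots> = (1 + q ^ (r + Suc M)) * (2 * qp_neg q (r + M) * q ^ triangle r * E (int M) * E (int (M + 2 * r)))"
    using Suc.IH unfolding V_def by simp
  also have "\<dots> = c * (2 * qp_neg q (r + Suc M) * q ^ triangle r * E (int (Suc M)) * E (int (Suc M + 2 * r)))"
    using qinv_Suc[of M] qinv_Suc[of "M + 2 * r"] by (simp add: c_def mult_ac del: of_nat_Suc)
  finally have *: "c * ((\<Sum>k\<le>Suc M. V (Suc M) k) * (1 + q ^ r)) =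
     c * (2 * qp_neg q (r + Suc M) * q ^ triangle r * E (int (Suc M)) * E (int (Suc M + 2 * r)))" .
  have "c \<noteq> 0" using one_minus_nz[of "Suc M"] one_minus_nz[of "Suc M + 2 * r"] by (simp add: c_def del: power_Suc)
  with * show ?case by (simp add: V_def del: of_nat_Suc)
qed

text \<open>The conjugate Bailey pair for the parameters -1 and infinity. The factor 1 + q^r clears
  the denominator of (-1;q)_r / (-q;q)_r = 2 / (1 + q^r). Terms with n < r vanish, and n = r + k
  reduces the rest to \<open>kernel_shifted\<close>.\<close>

lemma bailey_kernel:
  "(\<Sum>n\<le>N. qp_m1 q n * q ^ triangle n * E (int N - int n) *
       ((1 + q ^ r) * E (int n - int r) * E (int n + int r)))
     = 2 * qp_neg q N * q ^ triangle r * E (int N - int r) * E (int N + int r)"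
proof (cases "r \<le> N")
  case False
  then show ?thesis by (auto intro!: sum.neutral)
next
  case True
  then obtain M where M: "N = r + M" using le_Suc_ex by blast
  let ?f = "\<lambda>n. qp_m1 q n * q ^ triangle n * E (int N - int n) *
       ((1 + q ^ r) * E (int n - int r) * E (int n + int r))"
  have "(\<Sum>n\<le>N. ?f n) = (\<Sum>n\<in>{r..r+M}. ?f n)"
    by (rule sum.mono_neutral_right) (auto simp: M)
  also have "\<dots> = (\<Sum>k\<le>M. ?f (r + k))"
    by (rule sum.reindex_bij_witness[of _ "\<lambda>k. r + k" "\<lambda>n. n - r"]) auto
  also have "\<dots> = (\<Sum>k\<le>M. qp_m1 q (r + k) * q ^ triangle (r + k) * E (int (M - k)) * E (int k) * E (int (k + 2 * r)))
     * (1 + q ^ r)"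
    unfolding sum_distrib_right
    by (intro sum.cong refl) (simp add: M of_nat_diff algebra_simps)
  also have "\<dots> = 2 * qp_neg q (r + M) * q ^ triangle r * E (int M) * E (int (M + 2 * r))"
    by (rule kernel_shifted)
  finally show ?thesis by (simp add: M algebra_simps)
qed

end

text \<open>A partial sum of the two-sided series of (-1)^r q^(r^2), with the terms of r and -r
  merged.\<close>

definition theta :: "'a::field_char_0 fps \<Rightarrow> nat \<Rightarrow> 'a fps" where
  "theta q N = (\<Sum>r\<le>N. (if r = 0 then 1 else 2 * (-1) ^ r) * q ^ (r\<^sup>2))"

lemma triangle_ge: "n \<le> triangle n"
  by (induction n) auto

lemma triangle_add_pred: "triangle n + triangle (n - 1) = n\<^sup>2"
proof (cases n)
  case (Suc k)
  have "triangle (Suc k) + triangle k = (Suc k)\<^sup>2"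
    by (induction k) (simp_all add: power2_eq_square)
  with Suc show ?thesis by simp
qed simp

lemma half_times_two: "fps_const (1/2) * 2 = (1 :: 'a::field_char_0 fps)"
  by (simp add: numeral_fps_const)

text \<open>With x = q^(2r), y = q^k, p = q this settles the generic case n = 2r + k of the
  telescoping step in \<open>slater_bailey_pair\<close>.\<close>

lemma slater_ring_identity:
  fixes x y p :: "'a::comm_ring_1"
  shows "(1 + x) * ((1 - x*y*p) * (1 - x*x*y*y*p) - x*y * (1 - y*p) * (1 - x*x*y*p))
    = x * (1 - y) * (1 - y*p) + (1 - x*x*y) * (1 - x*x*y*p)"
  by (simp add: algebra_simps)

section \<open>Bailey's lemma in the limit and two Bailey pairs\<close>

context qbase
begin

lemma qinv_pred: "E (int k - 1) = (1 - q ^ k) * E (int k)"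
proof (cases k)
  case (Suc j)
  then show ?thesis using qinv_Suc[of j] by simp
qed simp

text \<open>The factors 1 - q^i with i > k are 1 modulo q^(k+1), so they are invisible at this
  precision.\<close>

lemma qinv_dvd: "k \<le> n \<Longrightarrow> q ^ Suc k dvd E (int n) - E (int k)"
proof (induction n rule: dec_induct)
  case (step n)
  have "E (int (Suc n)) - E (int n) = q ^ Suc n * E (int (Suc n))"
    using qinv_Suc[of n] by (simp add: algebra_simps del: of_nat_Suc)
  moreover have "q ^ Suc k dvd q ^ Suc n" using step by (intro le_imp_power_dvd) simp
  ultimately have "q ^ Suc k dvd E (int (Suc n)) - E (int n)" by (simp del: power_Suc of_nat_Suc)
  from dvd_add[OF this step.IH] show ?case by simp
qed simp

lemma qinv_unit: "E (int n) dvd 1"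
proof (induction n)
  case (Suc n)
  have "E (int (Suc n)) dvd E (int n)" by (subst (2) qinv_Suc) simp
  then show ?case using Suc dvd_trans by blast
qed simp

text \<open>Replacing N - n by N is exact only modulo q^(N-n+1); the exponent n(n+1)/2, being at
  least n, makes up for the loss.\<close>

lemma triangle_power_dvd:
  assumes "n \<le> N"
  shows "q ^ Suc N dvd q ^ triangle n * (E (int N - int n) - E (int N))"
proof -
  have "q ^ n dvd q ^ triangle n" by (intro le_imp_power_dvd triangle_ge)
  moreover have "q ^ Suc (N - n) dvd E (int N - int n) - E (int N)"
    using qinv_dvd[of "N - n" N] assms by (metis diff_le_self dvd_diff_commute of_nat_diff)
  moreover have "q ^ Suc N = q ^ n * q ^ Suc (N - n)"
    using assms by (simp flip: power_add power_Suc)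
  ultimately show ?thesis by (simp only: mult_dvd_mono)
qed

text \<open>The same trade-off for the other side of Bailey's lemma; for s > N the power of q
  suffices alone.\<close>

lemma triangle_power_dvd2:
  "q ^ Suc N dvd q ^ triangle s * (E (int N - int s) * E (int N + int s) - E (int N) * E (int N))"
proof (cases "s \<le> N")
  case True
  have "q ^ Suc N dvd E (int N + int s) - E (int N)"
    using qinv_dvd[of N "N + s"] by simp
  from dvd_add[OF dvd_mult2[OF triangle_power_dvd[OF True]] dvd_mult[OF this]]
  have "q ^ Suc N dvd q ^ triangle s * (E (int N - int s) - E (int N)) * E (int N + int s)
      + q ^ triangle s * E (int N) * (E (int N + int s) - E (int N))" .
  then show ?thesis by (simp add: algebra_simps del: power_Suc)
next
  case False
  then have "q ^ Suc N dvd q ^ triangle s"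
    using triangle_ge[of s] by (intro le_imp_power_dvd) simp
  then show ?thesis by (rule dvd_mult2)
qed

text \<open>Here \<open>\<alpha> i * (1 + q ^ s i)\<close> is the usual alpha of a Bailey pair
  relative to 1, placed at index \<open>s i\<close>. Summing \<open>bailey_kernel\<close> against
  \<open>\<alpha>\<close> gives an exact identity for finite \<open>N\<close>; its two sides are
  congruent to \<open>E (int N)\<close> times the two sides wanted, and that unit cancels.\<close>

lemma bailey_limit:
  assumes "finite I"
    and beta: "\<And>n. n \<le> N \<Longrightarrow>
      \<beta> n = (\<Sum>i\<in>I. \<alpha> i * ((1 + q ^ s i) * E (int n - int (s i)) * E (int n + int (s i))))"
  shows "q ^ Suc N dvd (\<Sum>n\<le>N. qp_m1 q n * q ^ triangle n * \<beta> n)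
      - qp_neg q N * E (int N) * (\<Sum>i\<in>I. 2 * \<alpha> i * q ^ triangle (s i))" (is "_ dvd ?A - ?B")
proof -
  let ?A' = "\<Sum>n\<le>N. qp_m1 q n * q ^ triangle n * E (int N - int n) * \<beta> n"
  let ?B' = "\<Sum>i\<in>I. 2 * \<alpha> i * qp_neg q N * q ^ triangle (s i) * E (int N - int (s i)) * E (int N + int (s i))"
  have "?A' = (\<Sum>n\<le>N. \<Sum>i\<in>I. \<alpha> i * (qp_m1 q n * q ^ triangle n * E (int N - int n) *
       ((1 + q ^ s i) * E (int n - int (s i)) * E (int n + int (s i)))))"
    by (intro sum.cong refl) (simp add: beta sum_distrib_left mult_ac)
  also have "\<dots> = (\<Sum>i\<in>I. \<alpha> i * (\<Sum>n\<le>N. qp_m1 q n * q ^ triangle n * E (int N - int n) *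
       ((1 + q ^ s i) * E (int n - int (s i)) * E (int n + int (s i)))))"
    by (subst sum.swap) (simp add: sum_distrib_left)
  also have "\<dots> = ?B'"
    unfolding bailey_kernel by (intro sum.cong refl) (simp only: mult_ac)
  \<comment> \<open>The exact finite form. From here on the arguments N - n, N - s and N + s are
    only replaced by N.\<close>
  finally have AB: "?A' = ?B'" .
  have "q ^ Suc N dvd (\<Sum>n\<le>N. qp_m1 q n * \<beta> n * (q ^ triangle n * (E (int N - int n) - E (int N))))"
    by (intro dvd_sum dvd_mult triangle_power_dvd) simp
  also have "\<dots> = ?A' - E (int N) * ?A"
    by (simp add: sum_distrib_left sum_subtractf algebra_simps)
  finally have 1: "q ^ Suc N dvd ?A' - E (int N) * ?A" .
  have "q ^ Suc N dvd (\<Sum>i\<in>I. 2 * \<alpha> i * qp_neg q N *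
      (q ^ triangle (s i) * (E (int N - int (s i)) * E (int N + int (s i)) - E (int N) * E (int N))))"
    by (intro dvd_sum dvd_mult triangle_power_dvd2)
  also have "\<dots> = ?B' - E (int N) * ?B"
    by (simp add: sum_distrib_left sum_subtractf algebra_simps)
  finally have "q ^ Suc N dvd (?B' - E (int N) * ?B) - (?A' - E (int N) * ?A)"
    using 1 by (rule dvd_diff)
  then have "q ^ Suc N dvd E (int N) * (?A - ?B)"
    unfolding AB by (simp add: algebra_simps del: power_Suc)
  then show ?thesis
    using qinv_unit[of N] by (simp add: dvd_mult_unit_iff' del: power_Suc)
qed

text \<open>The unit pair has alpha_r = (-1)^r q^(r(r-1)/2) (1 + q^r) for r > 0 and alpha_0 = 1,
  whence the coefficient 1/2 at r = 0, where 1 + q^r is 2. For n > 0 the terms times 1 - q^n are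
  differences of \<open>H\<close>, which vanishes at both ends.\<close>

lemma unit_bailey_pair:
  assumes "n \<le> R"
  shows "(\<Sum>r\<le>R. (if r = 0 then fps_const (1/2) else (-1) ^ r * q ^ triangle (r - 1)) *
      ((1 + q ^ r) * E (int n - int r) * E (int n + int r))) = (if n = 0 then 1 else 0)"
    (is "(\<Sum>r\<le>R. ?t r) = _")
proof -
  define H where "H r = (if r = 0 then 0 else (-1) ^ r * q ^ triangle (r - 1) *
    E (int n - int r) * E (int n + int r - 1))" for r
  have t0: "?t 0 = E (int n) * E (int n)"
    using half_times_two[where 'a = 'a] by (simp flip: mult.assoc)
  show ?thesis
  proof (cases "n = 0")
    case True
    have "(\<Sum>r\<le>R. ?t r) = (\<Sum>r\<in>{0}. ?t r)"
      by (rule sum.mono_neutral_right) (auto simp: True)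
    then show ?thesis using t0 True by simp
  next
    case False
    have "(1 - q ^ n) * ?t r = H r - H (Suc r)" for r
    proof -
      consider "r = 0" | "0 < r" "r \<le> n" | "n < r" by linarith
      then show ?thesis
      proof cases
        case 1
        then show ?thesis unfolding 1 t0
          using qinv_pred[of n] by (simp add: H_def mult_ac)
      next
        case 2
        then obtain k where k: "n = r + k" using le_Suc_ex by blast
        obtain p where p: "r = Suc p" using 2 gr0_implies_Suc by blast
        have e1: "E (int n + int r - 1) = (1 - q ^ (k + 2 * r)) * E (int n + int r)"
          using qinv_pred[of "k + 2 * r"] by (simp add: k algebra_simps)
        have e2: "E (int n - int (Suc r)) = (1 - q ^ k) * E (int n - int r)"
          using qinv_pred[of k] by (simp add: k algebra_simps)
        have e3: "E (int n + int (Suc r) - 1) = E (int n + int r)" by simp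
        have r2: "q ^ (k + 2 * r) = q ^ k * q ^ r * q ^ r" by (simp add: power_add mult_2)
        have e4: "q ^ triangle r = q ^ r * q ^ triangle (r - 1)" by (simp add: p power_add)
        show ?thesis
          using 2 unfolding H_def e1 e2 e3 r2
          by (simp add: e4 k power_add algebra_simps)
      next
        case 3
        then show ?thesis by (simp add: H_def)
      qed
    qed
    then have "(1 - q ^ n) * (\<Sum>r\<le>R. ?t r) = (\<Sum>r<Suc R. H r - H (Suc r))"
      unfolding sum_distrib_left lessThan_Suc_atMost by (intro sum.cong refl)
    also have "\<dots> = H 0 - H (Suc R)" by (rule sum_lessThan_telescope')
    also have "\<dots> = 0" using assms by (simp add: H_def)
    finally show ?thesis using one_minus_nz[of n] False by simp
  qed
qed

text \<open>Gauss's evaluation of the theta series as (q;q)_inf / (-q;q)_inf, from the unit pair: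
  r(r-1)/2 and r(r+1)/2 add up to r^2. The cut-off \<open>R\<close> is separate from the precision
  \<open>N\<close> because the theorem combines length m in base q^3 with a theta series cut at
  3m.\<close>

lemma gauss_theta:
  assumes "N \<le> R"
  shows "q ^ Suc N dvd 1 - qp_neg q N * E (int N) * theta q R"
proof -
  let ?\<alpha> = "\<lambda>r. if r = 0 then fps_const (1/2) else (-1) ^ r * q ^ triangle (r - 1)"
  have "q ^ Suc N dvd (\<Sum>n\<le>N. qp_m1 q n * q ^ triangle n * (if n = 0 then 1 else 0))
      - qp_neg q N * E (int N) * (\<Sum>r\<le>R. 2 * ?\<alpha> r * q ^ triangle r)"
    using assms by (intro bailey_limit[where s = "\<lambda>r. r"] unit_bailey_pair[symmetric]) auto
  also have "(\<Sum>n\<le>N. qp_m1 q n * q ^ triangle n * (if n = 0 then 1 else 0)) = (1 :: 'a fps)"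
    by (simp add: sum.delta if_distrib cong: if_cong)
  also have "(\<Sum>r\<le>R. 2 * ?\<alpha> r * q ^ triangle r) = theta q R"
    unfolding theta_def
    by (intro sum.cong refl) (use half_times_two[where 'a = 'a] in \<open>auto simp: mult_ac simp flip: power_add triangle_add_pred\<close>)
  finally show ?thesis .
qed

text \<open>The alpha of this pair lives on the even indices 2r. Passing from n to n + 1 multiplies
  the right-hand side by q^n / ((1 - q^(n+1)) (1 - q^(2n+1))), and the summand obeys the same
  recurrence up to a telescoping difference in \<open>r\<close>.\<close>

lemma slater_bailey_pair:
  assumes "n \<le> R"
  shows "(\<Sum>r\<le>R. (if r = 0 then fps_const (1/2) else (-1) ^ r * q ^ (r * (r - 1))) *
      ((1 + q ^ (2 * r)) * E (int n - int (2 * r)) * E (int n + int (2 * r))))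
    = q ^ triangle (n - 1) * E (int n) * qinv_odd q n"
  using assms
proof (induction n)
  case 0
  let ?t = "\<lambda>r. (if r = 0 then fps_const (1/2) else (-1) ^ r * q ^ (r * (r - 1))) *
      ((1 + q ^ (2 * r)) * E (int 0 - int (2 * r)) * E (int 0 + int (2 * r)))"
  have "(\<Sum>r\<le>R. ?t r) = (\<Sum>r\<in>{0}. ?t r)"
    by (rule sum.mono_neutral_right) auto
  then show ?case using half_times_two[where 'a = 'a] by simp
next
  case (Suc n)
  define t where "t n r = (if r = 0 then fps_const (1/2) else (-1) ^ r * q ^ (r * (r - 1))) *
      ((1 + q ^ (2 * r)) * E (int n - int (2 * r)) * E (int n + int (2 * r)))" for n r
  \<comment> \<open>The certificate is set to 0 at r = 0, where the one-sided sum begins; at the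
    upper end \<open>G (Suc R)\<close> vanishes through a negative argument of
    \<open>E\<close>.\<close>
  define G where "G r = (if r = 0 then 0 else - ((-1) ^ r * q ^ (r * (r - 1)) *
    E (int n + 1 - int (2 * r)) * E (int n - 1 + int (2 * r))))" for r
  define c where "c = (1 - q ^ Suc n) * (1 - q ^ (2 * n + 1))"
  have t0: "t n 0 = E (int n) * E (int n)" for n
    using half_times_two[where 'a = 'a] by (simp add: t_def flip: mult.assoc)
  have step: "c * t (Suc n) r - q ^ n * t n r = G (Suc r) - G r" for r
  proof -
    consider "r = 0" | "0 < r" "2 * r \<le> n" | "0 < r" "Suc n = 2 * r" | "Suc n < 2 * r" by linarith
    then show ?thesis
    proof cases
      case 1
      define e x where "e = E (int (Suc n))" and "x = q ^ n"
      have e: "E (int n) = (1 - x * q) * e"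
        using qinv_Suc[of n] by (simp add: e_def x_def mult_ac)
      have "G (Suc 0) = E (int n - 1) * e"
        by (simp add: G_def e_def algebra_simps)
      then have G1: "G (Suc 0) = (1 - x) * (1 - x * q) * (e * e)"
        using qinv_pred[of n] by (simp add: e x_def mult_ac)
      have c: "c = (1 - x * q) * (1 - x * x * q)"
        by (simp add: c_def x_def mult_2 power_add) (simp add: mult_ac)
      show ?thesis
        unfolding 1 t0 c G1 e e_def[symmetric] x_def[symmetric]
        by (simp add: G_def algebra_simps)
    next
      case 2
      then obtain k where k: "n = 2 * r + k" using le_Suc_ex by blast
      obtain p where p: "r = Suc p" using 2 gr0_implies_Suc by blast
      define w where "w = (-1) ^ r * q ^ (r * (r - 1)) * E (int (Suc k)) * E (int (Suc (k + 4 * r)))"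
      have t1: "t (Suc n) r = (1 + q ^ (2 * r)) * w"
        using 2 by (simp add: t_def w_def k mult_ac add_ac)
      have e1: "E (int n - int (2 * r)) = (1 - q ^ Suc k) * E (int (Suc k))"
        using qinv_Suc[of k] by (simp add: k)
      have "E (int n + int (2 * r)) = E (int (k + 4 * r))" by (simp add: k add_ac)
      also have "\<dots> = (1 - q ^ Suc (k + 4 * r)) * E (int (Suc (k + 4 * r)))" by (rule qinv_Suc)
      finally have e2: "E (int n + int (2 * r)) = (1 - q ^ Suc (k + 4 * r)) * E (int (Suc (k + 4 * r)))" .
      have tn: "t n r = (1 + q ^ (2 * r)) * ((1 - q ^ Suc k) * (1 - q ^ Suc (k + 4 * r)) * w)"
        using 2 unfolding t_def e1 e2 w_def by (simp add: mult_ac del: of_nat_Suc power_Suc)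
      have "E (int n - 1 + int (2 * r)) = E (int (k + 4 * r) - 1)" by (simp add: k algebra_simps)
      also have "\<dots> = (1 - q ^ (k + 4 * r)) * ((1 - q ^ Suc (k + 4 * r)) * E (int (Suc (k + 4 * r))))"
        by (subst qinv_pred, subst qinv_Suc) (rule refl)
      finally have e3: "E (int n - 1 + int (2 * r))
        = (1 - q ^ (k + 4 * r)) * ((1 - q ^ Suc (k + 4 * r)) * E (int (Suc (k + 4 * r))))" .
      have e4: "E (int n + 1 - int (2 * r)) = E (int (Suc k))" by (simp add: k add_ac)
      have Gr: "G r = - ((1 - q ^ (k + 4 * r)) * (1 - q ^ Suc (k + 4 * r)) * w)"
        using 2 unfolding G_def e3 e4 w_def by (simp add: mult_ac del: of_nat_Suc power_Suc)
      have "E (int n + 1 - int (2 * Suc r)) = E (int k - 1)" by (simp add: k)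
      also have "\<dots> = (1 - q ^ k) * ((1 - q ^ Suc k) * E (int (Suc k)))"
        by (subst qinv_pred, subst qinv_Suc) (rule refl)
      finally have e5: "E (int n + 1 - int (2 * Suc r)) = (1 - q ^ k) * ((1 - q ^ Suc k) * E (int (Suc k)))" .
      have e6: "E (int n - 1 + int (2 * Suc r)) = E (int (Suc (k + 4 * r)))" by (simp add: k add_ac)
      have e7: "q ^ (Suc r * (Suc r - 1)) = q ^ (2 * r) * q ^ (r * (r - 1))"
        unfolding power_add[symmetric] by (rule arg_cong[where f = "power q"]) (simp add: p)
      have GS: "G (Suc r) = q ^ (2 * r) * (1 - q ^ k) * (1 - q ^ Suc k) * w"
        unfolding G_def e5 e6 e7 w_def by (simp add: mult_ac del: of_nat_Suc)
      define x y where "x = q ^ (2 * r)" and "y = q ^ k"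
      have x4: "q ^ (4 * r) = x * x" and yn: "q ^ (2 * n) = q ^ n * q ^ n"
        by (simp add: x_def flip: power_add) (simp add: mult_2 flip: power_add)
      have xy: "q ^ n = x * y" "q ^ Suc n = x * y * q" "q ^ (2 * n + 1) = x * x * y * y * q" "q ^ Suc k = y * q"
        "q ^ (k + 4 * r) = x * x * y" "q ^ Suc (k + 4 * r) = x * x * y * q"
        by (simp_all add: power_add x4 yn) (simp_all add: x_def y_def k power_add mult_ac)
      have "c * t (Suc n) r - q ^ n * t n r =
         (1 + x) * ((1 - x*y*q) * (1 - x*x*y*y*q) - x*y * (1 - y*q) * (1 - x*x*y*q)) * w"
        unfolding t1 tn c_def xy x_def[symmetric] by (simp add: algebra_simps)
      also have "\<dots> = (x * (1 - y) * (1 - y*q) + (1 - x*x*y) * (1 - x*x*y*q)) * w"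
        unfolding slater_ring_identity ..
      also have "\<dots> = G (Suc r) - G r"
        unfolding Gr GS xy x_def[symmetric] y_def[symmetric] by (simp add: algebra_simps)
      finally show ?thesis .
    next
      \<comment> \<open>The boundary case: the r-th term first appears at
        \<open>Suc n = 2 * r\<close>, so \<open>t n r\<close> and \<open>G (Suc r)\<close> are still
        0.\<close>
      case 3
      then have n: "int n = 2 * int r - 1" by linarith
      obtain p where p: "r = Suc p" using 3 gr0_implies_Suc by blast
      have np: "n = Suc (2 * p)" using 3 p by simp
      define w where "w = (-1) ^ r * q ^ (r * (r - 1)) * E (int (4 * r))"
      have "E (int n - 1 + int (2 * r)) = E (int (2 * n + 1) - 1)" by (simp add: np p add_ac)
      also have "\<dots> = (1 - q ^ (2 * n + 1)) * ((1 - q ^ Suc (2 * n + 1)) * E (int (Suc (2 * n + 1))))"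
        by (subst qinv_pred, subst qinv_Suc) (rule refl)
      also have "Suc (2 * n + 1) = 4 * r" by (simp add: np p)
      finally have e: "E (int n - 1 + int (2 * r)) = (1 - q ^ (2 * n + 1)) * ((1 - q ^ (4 * r)) * E (int (4 * r)))" .
      have "G r = - ((1 - q ^ (2 * n + 1)) * ((1 - q ^ (4 * r)) * w))"
        using 3(1) unfolding G_def e by (simp add: n w_def mult_ac)
      moreover have "t (Suc n) r = (1 + q ^ (2 * r)) * w"
        using 3(1) n by (simp add: t_def w_def mult_ac)
      moreover have "1 - q ^ (4 * r) = (1 - q ^ Suc n) * (1 + q ^ (2 * r))"
        unfolding 3(2) by (simp add: algebra_simps flip: power_add)
      moreover have "t n r = 0" "G (Suc r) = 0"
        by (simp_all add: t_def G_def n)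
      ultimately show ?thesis by (simp add: c_def mult_ac)
    next
      case 4
      then show ?thesis by (auto simp: t_def G_def)
    qed
  qed
  have "c * (\<Sum>r\<le>R. t (Suc n) r) - q ^ n * (\<Sum>r\<le>R. t n r) = (\<Sum>r<Suc R. G (Suc r) - G r)"
    unfolding sum_distrib_left lessThan_Suc_atMost sum_subtractf[symmetric] by (intro sum.cong refl step)
  also have "\<dots> = G (Suc R) - G 0" by (rule sum_lessThan_telescope)
  also have "\<dots> = 0" using Suc.prems by (simp add: G_def)
  finally have "c * (\<Sum>r\<le>R. t (Suc n) r) = q ^ n * (\<Sum>r\<le>R. t n r)" by simp
  also have "(\<Sum>r\<le>R. t n r) = q ^ triangle (n - 1) * E (int n) * qinv_odd q n"
    using Suc by (simp add: t_def)
  also have "q ^ n * \<dots> = (q ^ n * q ^ triangle (n - 1)) * (E (int n) * qinv_odd q n)"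
    by (simp only: mult_ac)
  also have "q ^ n * q ^ triangle (n - 1) = q ^ triangle n"
    by (cases n) (simp_all add: power_add mult_ac)
  also have "q ^ triangle n * (E (int n) * qinv_odd q n)
      = c * (q ^ triangle (Suc n - 1) * E (int (Suc n)) * qinv_odd q (Suc n))"
    by (subst qinv_Suc, subst qinv_odd_Suc) (simp add: c_def mult_ac)
  finally have "c * (\<Sum>r\<le>R. t (Suc n) r)
    = c * (q ^ triangle (Suc n - 1) * E (int (Suc n)) * qinv_odd q (Suc n))" .
  moreover have "c \<noteq> 0" using one_minus_nz[of "Suc n"] one_minus_nz[of "2 * n + 1"] by (simp add: c_def del: power_Suc)
  ultimately have "(\<Sum>r\<le>R. t (Suc n) r) = q ^ triangle (Suc n - 1) * E (int (Suc n)) * qinv_odd q (Suc n)"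
    using mult_cancel_left by blast
  then show ?case unfolding t_def .
qed

text \<open>On the beta side n(n+1)/2 + n(n-1)/2 = n^2. On the alpha side r(r-1) + r(2r+1) = 3r^2,
  which is why theta appears in base q^3.\<close>

lemma slater_sum:
  "q ^ Suc N dvd (\<Sum>n\<le>N. q ^ (n\<^sup>2) * qp_m1 q n * E (int n) * qinv_odd q n)
      - qp_neg q N * E (int N) * theta (q ^ 3) N"
proof -
  let ?\<alpha> = "\<lambda>r. if r = 0 then fps_const (1/2) else (-1) ^ r * q ^ (r * (r - 1))"
  have "q ^ Suc N dvd (\<Sum>n\<le>N. qp_m1 q n * q ^ triangle n * (q ^ triangle (n - 1) * E (int n) * qinv_odd q n))
      - qp_neg q N * E (int N) * (\<Sum>r\<le>N. 2 * ?\<alpha> r * q ^ triangle (2 * r))"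
    by (intro bailey_limit[where s = "\<lambda>r. 2 * r"] slater_bailey_pair[symmetric]) auto
  also have "(\<Sum>n\<le>N. qp_m1 q n * q ^ triangle n * (q ^ triangle (n - 1) * E (int n) * qinv_odd q n))
    = (\<Sum>n\<le>N. q ^ (n\<^sup>2) * qp_m1 q n * E (int n) * qinv_odd q n)"
    by (intro sum.cong refl) (simp add: mult_ac power_add flip: triangle_add_pred)
  also have "(\<Sum>r\<le>N. 2 * ?\<alpha> r * q ^ triangle (2 * r)) = theta (q ^ 3) N"
    unfolding theta_def
  proof (intro sum.cong refl)
    fix r
    have "r * (r - 1) + triangle (2 * r) = 3 * r\<^sup>2"
      by (cases r) (simp_all add: triangle_def power2_eq_square algebra_simps)
    then have "q ^ (r * (r - 1)) * q ^ triangle (2 * r) = (q ^ 3) ^ (r\<^sup>2)"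
      by (simp flip: power_add power_mult)
    then show "2 * ?\<alpha> r * q ^ triangle (2 * r) = (if r = 0 then 1 else 2 * (-1) ^ r) * (q ^ 3) ^ (r\<^sup>2)"
      using half_times_two[where 'a = 'a] by (auto simp: mult_ac)
  qed
  finally show ?thesis .
qed

end

section \<open>Generating functions of weighted classes\<close>

text \<open>Finiteness is demanded because \<open>card\<close> is 0 on infinite sets.\<close>

definition has_gf :: "'b set \<Rightarrow> ('b \<Rightarrow> nat) \<Rightarrow> rat fps \<Rightarrow> bool" where
  "has_gf A w f \<longleftrightarrow> (\<forall>n. finite {x\<in>A. w x = n} \<and> fps_nth f n = of_nat (card {x\<in>A. w x = n}))"

lemma has_gf_bij:
  assumes "has_gf A w f" and "bij_betw g A B" and "\<And>x. x \<in> A \<Longrightarrow> v (g x) = w x"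
  shows "has_gf B v f"
proof -
  have "{y\<in>B. v y = n} = g ` {x\<in>A. w x = n}" and "inj_on g {x\<in>A. w x = n}" for n
    using assms(2,3) by (auto simp: bij_betw_def inj_on_def)
  then show ?thesis
    using assms(1) by (simp add: has_gf_def card_image)
qed

lemma has_gf_cong:
  assumes "has_gf A w f" and "A = B" and "\<And>x. x \<in> A \<Longrightarrow> v x = w x" and "f = g"
  shows "has_gf B v g"
  using has_gf_bij[OF assms(1), of id B v] assms by auto

lemma has_gf_Times:
  assumes "has_gf A w f" and "has_gf B v g"
  shows "has_gf (A \<times> B) (\<lambda>(x, y). w x + v y) (f * g)"
  unfolding has_gf_def
proof (intro allI conjI)
  fix n
  let ?P = "\<lambda>i. {x\<in>A. w x = i} \<times> {y\<in>B. v y = n - i}"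
  have eq: "{z \<in> A \<times> B. (case z of (x, y) \<Rightarrow> w x + v y) = n} = (\<Union>i\<in>{0..n}. ?P i)"
    by auto
  have fin: "finite (?P i)" for i
    using assms unfolding has_gf_def by blast
  then show "finite {z \<in> A \<times> B. (case z of (x, y) \<Rightarrow> w x + v y) = n}"
    unfolding eq by blast
  have "card (\<Union>i\<in>{0..n}. ?P i) = (\<Sum>i=0..n. card (?P i))"
    using fin by (intro card_UN_disjoint) auto
  then show "fps_nth (f * g) n = of_nat (card {z \<in> A \<times> B. (case z of (x, y) \<Rightarrow> w x + v y) = n})"
    using assms unfolding eq by (simp add: fps_mult_nth card_cartesian_product has_gf_def)
qed

lemma has_gf_UN:
  assumes "finite I" and "\<And>i. i \<in> I \<Longrightarrow> has_gf (A i) w (f i)"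
    and "\<And>i j. i \<in> I \<Longrightarrow> j \<in> I \<Longrightarrow> i \<noteq> j \<Longrightarrow> A i \<inter> A j = {}"
  shows "has_gf (\<Union>i\<in>I. A i) w (\<Sum>i\<in>I. f i)"
  unfolding has_gf_def
proof (intro allI conjI)
  fix n
  have eq: "{x \<in> \<Union>i\<in>I. A i. w x = n} = (\<Union>i\<in>I. {x \<in> A i. w x = n})" by auto
  have fin: "finite {x \<in> A i. w x = n}" if "i \<in> I" for i
    using assms(2)[OF that] unfolding has_gf_def by blast
  then show "finite {x \<in> \<Union>i\<in>I. A i. w x = n}"
    unfolding eq using assms(1) by blast
  have "card (\<Union>i\<in>I. {x \<in> A i. w x = n}) = (\<Sum>i\<in>I. card {x \<in> A i. w x = n})"
    using assms(1,3) fin by (intro card_UN_disjoint) blast+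
  then show "fps_nth (\<Sum>i\<in>I. f i) n = of_nat (card {x \<in> \<Union>i\<in>I. A i. w x = n})"
    using assms(2) unfolding eq by (simp add: fps_sum_nth has_gf_def)
qed

lemma has_gf_singleton: "has_gf {x} w (fps_X ^ w x)"
  unfolding has_gf_def
proof (intro allI)
  fix n
  have "{y \<in> {x}. w y = n} = (if w x = n then {x} else {})" by auto
  then show "finite {y \<in> {x}. w y = n} \<and> fps_nth (fps_X ^ w x) n = of_nat (card {y \<in> {x}. w y = n})"
    by (simp add: fps_X_power_nth)
qed

text \<open>The case \<open>c = 0\<close> is a choice without cost and gives the factor 2.\<close>

lemma has_gf_bool: "has_gf UNIV (\<lambda>b. c * of_bool b) (1 + fps_X ^ c)"
proof -
  have "has_gf (\<Union>b\<in>UNIV. {b}) (\<lambda>b. c * of_bool b) (\<Sum>b\<in>UNIV. fps_X ^ (c * of_bool b))"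
    by (intro has_gf_UN has_gf_singleton) auto
  then show ?thesis by (simp add: UNIV_bool insert_commute)
qed

lemma has_gf_shift:
  assumes "has_gf A w f"
  shows "has_gf A (\<lambda>x. w x + c) (fps_X ^ c * f)"
proof -
  have "has_gf ({()} \<times> A) (\<lambda>(u, x). c + w x) (fps_X ^ c * f)"
    using has_gf_Times[OF has_gf_singleton[of "()" "\<lambda>_. c"] assms] by simp
  then show ?thesis
    by (rule has_gf_bij[where g = snd]) (auto simp: bij_betw_def inj_on_def image_def)
qed

lemma has_gf_multiples:
  assumes "0 < c"
  shows "has_gf UNIV (\<lambda>d. c * d) (inverse (1 - fps_X ^ c))"
proof -
  define F :: "rat fps" where "F = Abs_fps (\<lambda>n. of_bool (c dvd n))"
  have "(1 - fps_X ^ c) * F = 1"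
  proof (rule fps_ext)
    fix n
    show "fps_nth ((1 - fps_X ^ c) * F) n = fps_nth 1 n"
      using assms by (auto simp: left_diff_distrib fps_X_power_mult_nth F_def dvd_minus_self not_less
          dest: dvd_imp_le)
  qed
  then have F: "inverse (1 - fps_X ^ c) = F" by (rule fps_inverse_unique)
  show ?thesis
    unfolding F has_gf_def
  proof (intro allI)
    fix n
    have "{d \<in> UNIV. c * d = n} = (if c dvd n then {n div c} else {})"
      using assms by auto
    then show "finite {d \<in> UNIV. c * d = n} \<and> fps_nth F n = of_nat (card {d \<in> UNIV. c * d = n})"
      by (simp add: F_def)
  qed
qed

section \<open>Overpartitions with prescribed part sizes\<close>

definition overpartitions_in :: "nat set \<Rightarrow> (nat multiset \<times> nat set) set" where
  "overpartitions_in S = {(P, Ov). set_mset P \<subseteq> S \<and> Ov \<subseteq> set_mset P}"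

text \<open>Part sizes are independent: each admits an optional overlined copy and any number of
  plain ones. The induction splits off one size.\<close>

lemma overpartitions_in_gf:
  assumes "finite S" and "0 \<notin> S"
  shows "has_gf (overpartitions_in S) (\<lambda>(P, Ov). sum_mset P)
    (\<Prod>i\<in>S. (1 + fps_X ^ i) * inverse (1 - fps_X ^ i))"
  using assms
proof (induction S rule: finite_induct)
  case empty
  have "overpartitions_in {} = {({#}, {})}" by (auto simp: overpartitions_in_def)
  then show ?case
    using has_gf_singleton[of "({#}, {})" "\<lambda>(P, Ov). sum_mset P"] by simp
next
  case (insert i S)
  \<comment> \<open>\<open>c\<close> counts the plain copies of \<open>i\<close> only;
    \<open>b\<close> tells whether an overlined copy is added.\<close>
  define g :: "(nat multiset \<times> nat set) \<times> bool \<times> nat \<Rightarrow> nat multiset \<times> nat set" where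
    "g = (\<lambda>((P, Ov), (b, c)). (P + replicate_mset (c + of_bool b) i, if b then insert i Ov else Ov))"
  define h :: "nat multiset \<times> nat set \<Rightarrow> (nat multiset \<times> nat set) \<times> bool \<times> nat" where
    "h = (\<lambda>(P, Ov). ((filter_mset (\<lambda>x. x \<noteq> i) P, Ov - {i}), (i \<in> Ov, count P i - of_bool (i \<in> Ov))))"
  have bij: "bij_betw g (overpartitions_in S \<times> UNIV) (overpartitions_in (insert i S))"
  proof (rule bij_betw_byWitness[where f' = h])
    show "\<forall>x\<in>overpartitions_in S \<times> UNIV. h (g x) = x"
    proof clarify
      fix P Ov b c
      assume "(P, Ov) \<in> overpartitions_in S"
      then have *: "i \<notin># P" "i \<notin> Ov"
        using insert.hyps by (auto simp: overpartitions_in_def)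
      then have "filter_mset (\<lambda>x. x \<noteq> i) P = P"
        by (intro multiset_eqI) (auto simp: not_in_iff)
      moreover have "filter_mset (\<lambda>x. x \<noteq> i) (replicate_mset k i) = {#}" for k
        by (induction k) auto
      ultimately show "h (g ((P, Ov), (b, c))) = ((P, Ov), (b, c))"
        using * by (auto simp: g_def h_def not_in_iff)
    qed
    show "\<forall>x\<in>overpartitions_in (insert i S). g (h x) = x"
    proof clarify
      fix P Ov
      assume "(P, Ov) \<in> overpartitions_in (insert i S)"
      then have "i \<in> Ov \<Longrightarrow> 0 < count P i"
        by (auto simp: overpartitions_in_def)
      moreover have "filter_mset (\<lambda>x. x \<noteq> i) P + replicate_mset (count P i) i = P"
        by (rule multiset_eqI) simp
      ultimately show "g (h (P, Ov)) = (P, Ov)"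
        by (auto simp: g_def h_def)
    qed
    show "g ` (overpartitions_in S \<times> UNIV) \<subseteq> overpartitions_in (insert i S)"
      by (auto simp: g_def overpartitions_in_def split: if_splits)
    show "h ` overpartitions_in (insert i S) \<subseteq> overpartitions_in S \<times> UNIV"
      by (auto simp: h_def overpartitions_in_def)
  qed
  have "has_gf (overpartitions_in S \<times> UNIV)
      (\<lambda>(x, y). (case x of (P, Ov) \<Rightarrow> sum_mset P) + (case y of (b, c) \<Rightarrow> i * of_bool b + i * c))
      ((\<Prod>i\<in>S. (1 + fps_X ^ i) * inverse (1 - fps_X ^ i)) * ((1 + fps_X ^ i) * inverse (1 - fps_X ^ i)))"
    using insert has_gf_Times[OF has_gf_bool has_gf_multiples, of i i]
    by (intro has_gf_Times) auto
  from has_gf_bij[OF this bij] have "has_gf (overpartitions_in (insert i S)) (\<lambda>(P, Ov). sum_mset P)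
      ((\<Prod>i\<in>S. (1 + fps_X ^ i) * inverse (1 - fps_X ^ i)) * ((1 + fps_X ^ i) * inverse (1 - fps_X ^ i)))"
    by (auto simp: g_def algebra_simps)
  then show ?case using insert.hyps by (simp add: mult.commute)
qed

lemma J_eq_coeff:
  assumes "m \<le> N"
  shows "of_nat (J m) =
    fps_nth (\<Prod>i | i \<in> {1..N} \<and> \<not> 3 dvd i. (1 + fps_X ^ i) * inverse (1 - fps_X ^ i) :: rat fps) m"
proof -
  let ?S = "{i. i \<in> {1..N} \<and> \<not> 3 dvd i}"
  have "p \<le> sum_mset P" if "p \<in># P" for p and P :: "nat multiset"
    using that by (metis le_add1 multi_member_split sum_mset.add_mset)
  then have "J_set m = {x \<in> overpartitions_in ?S. (case x of (P, Ov) \<Rightarrow> sum_mset P) = m}"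
    using assms by (fastforce simp: J_set_def overpartitions_in_def)
  moreover have "has_gf (overpartitions_in ?S) (\<lambda>(P, Ov). sum_mset P)
    (\<Prod>i\<in>?S. (1 + fps_X ^ i) * inverse (1 - fps_X ^ i))"
    by (rule overpartitions_in_gf) auto
  ultimately show ?thesis by (simp add: has_gf_def J_def)
qed

section \<open>Overpartitions with \<open>n\<close> copies of \<open>n\<close>\<close>

type_synonym marked_part = "(nat \<times> nat) \<times> bool"

definition part_sum :: "marked_part list \<Rightarrow> nat" where
  "part_sum ys = sum_list (map (\<lambda>y. fst (fst y)) ys)"

text \<open>The bound \<open>b\<close> is \<open>n + j\<close> for the preceding part \<open>n\<^sub>j\<close>, so that the weighted difference of
  the next part \<open>n'\<^sub>j\<^sub>'\<close> is \<open>n' - j' - b\<close>; an overline on a non-initial part needs it to be positive.\<close>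

fun chain_above :: "nat \<Rightarrow> marked_part list \<Rightarrow> bool" where
  "chain_above b [] \<longleftrightarrow> True"
| "chain_above b (((n, j), f) # ys) \<longleftrightarrow> 1 \<le> j \<and> b + j + of_bool f \<le> n \<and> chain_above (n + j) ys"

fun full_chain :: "marked_part list \<Rightarrow> bool" where
  "full_chain [] \<longleftrightarrow> True"
| "full_chain (((n, j), f) # ys) \<longleftrightarrow> 1 \<le> j \<and> j \<le> n \<and> chain_above (n + j) ys"

text \<open>An entry \<open>(f, d, j)\<close> stands for a part with subscript \<open>j + 1\<close>, overlined iff \<open>f\<close>, whose weighted
  difference is \<open>d\<close>, plus one if it is overlined: every list of entries is then allowed.\<close>

fun build :: "nat \<Rightarrow> (bool \<times> nat \<times> nat) list \<Rightarrow> marked_part list" where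
  "build b [] = []"
| "build b ((f, d, j) # cs) =
    ((b + d + of_bool f + Suc j, Suc j), f)
      # build (b + d + of_bool f + Suc j + Suc j) cs"

fun unbuild :: "nat \<Rightarrow> marked_part list \<Rightarrow> (bool \<times> nat \<times> nat) list" where
  "unbuild b [] = []"
| "unbuild b (((n, j), f) # ys) = (f, n - j - b - of_bool f, j - 1) # unbuild (n + j) ys"

text \<open>The sum of the parts built from bound 0. An overline or a unit of \<open>d\<close> lifts
  the current part and all later ones by 1. A unit of subscript lifts the current part by 1 and all
  later ones by 2, since it enters the next bound n + j twice.\<close>

fun code_weight :: "(bool \<times> nat \<times> nat) list \<Rightarrow> nat" where
  "code_weight [] = 0"
| "code_weight ((f, d, j) # cs) = Suc (length cs) * of_bool f + Suc (length cs) * d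
    + (2 * length cs + 1) * Suc j + code_weight cs"

lemma part_sum_simps [simp]: "part_sum [] = 0" "part_sum (y # ys) = fst (fst y) + part_sum ys"
  by (simp_all add: part_sum_def)

text \<open>Raising the initial bound by 1 raises every part by 1.\<close>

lemma part_sum_build: "part_sum (build b cs) = length cs * b + code_weight cs"
  by (induction b cs rule: build.induct) (simp_all add: algebra_simps)

lemma length_build [simp]: "length (build b cs) = length cs"
  by (induction b cs rule: build.induct) simp_all

lemma chain_build: "chain_above b (build b cs)"
  by (induction b cs rule: build.induct) simp_all

lemma length_unbuild [simp]: "length (unbuild b ys) = length ys"
  by (induction b ys rule: unbuild.induct) simp_all

lemma unbuild_build: "unbuild b (build b cs) = cs"
  by (induction b cs rule: build.induct) simp_all

lemma build_unbuild: "chain_above b ys \<Longrightarrow> build b (unbuild b ys) = ys"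
proof (induction b ys rule: unbuild.induct)
  case (2 b n j f ys)
  then have *: "b + (n - j - b - of_bool f) + of_bool f + j = n" "Suc (j - 1) = j"
    by auto
  from 2 show ?case by (simp only: build.simps unbuild.simps chain_above.simps *)
qed simp

section \<open>Generating functions of chains of given length\<close>

definition step_gf :: "nat \<Rightarrow> rat fps" where
  "step_gf k = fps_X ^ (2 * k + 1) * inverse (1 - fps_X ^ (2 * k + 1))"

lemma has_gf_step: "has_gf UNIV (\<lambda>j. (2 * k + 1) * Suc j) (step_gf k)"
  using has_gf_shift[OF has_gf_multiples[of "2 * k + 1"], of "2 * k + 1"]
  by (simp add: step_gf_def algebra_simps)

text \<open>The index \<open>k\<close> is the number of entries after the current one, that is,
  \<open>length cs\<close> in \<open>code_weight\<close>.\<close>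

definition code_gf :: "nat \<Rightarrow> rat fps" where
  "code_gf r = (\<Prod>k<r. (1 + fps_X ^ Suc k) * (inverse (1 - fps_X ^ Suc k) * step_gf k))"

lemma has_gf_codes: "has_gf {cs. length cs = r} code_weight (code_gf r)"
proof (induction r)
  case 0
  have "{cs :: (bool \<times> nat \<times> nat) list. length cs = 0} = {[]}" by auto
  then show ?case using has_gf_singleton[of "[]" code_weight] by (simp add: code_gf_def)
next
  case (Suc r)
  let ?W = "\<lambda>((f, d, j), cs). (Suc r * of_bool f + (Suc r * d + (2 * r + 1) * Suc j)) + code_weight cs"
  have "has_gf (UNIV \<times> {cs. length cs = r}) ?W
      (((1 + fps_X ^ Suc r) * (inverse (1 - fps_X ^ Suc r) * step_gf r)) * code_gf r)"
    using has_gf_Times[OF has_gf_Times[OF has_gf_bool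
      has_gf_Times[OF has_gf_multiples[OF zero_less_Suc[of r]] has_gf_step[of r]], of "Suc r"] Suc]
    by (elim has_gf_cong) auto
  moreover have "bij_betw (\<lambda>(c, cs). c # cs) (UNIV \<times> {cs. length cs = r})
      {cs :: (bool \<times> nat \<times> nat) list. length cs = Suc r}"
    by (auto simp: bij_betw_def inj_on_def image_def length_Suc_conv)
  ultimately have "has_gf {cs. length cs = Suc r} code_weight
      (((1 + fps_X ^ Suc r) * (inverse (1 - fps_X ^ Suc r) * step_gf r)) * code_gf r)"
    by (rule has_gf_bij) auto
  then show ?case by (simp add: code_gf_def mult.commute)
qed

text \<open>The first part has no predecessor, so its bound is 0 and its overline is free: 1 +
  q^(l+1) gives way to 1 + q^0 = 2. This is the source of (-1;q)_r in place of (-q;q)_r.\<close>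

lemma full_chain_gf:
  "has_gf {ys. full_chain ys \<and> length ys = Suc l} part_sum
    (2 * (inverse (1 - fps_X ^ Suc l) * step_gf l) * code_gf l)"
proof -
  let ?W = "\<lambda>((f, d, j), cs). (0 * of_bool f + (Suc l * d + (2 * l + 1) * Suc j)) + code_weight cs"
  let ?C = "UNIV \<times> {cs :: (bool \<times> nat \<times> nat) list. length cs = l}"
  have "has_gf ?C ?W (((1 + fps_X ^ 0) * (inverse (1 - fps_X ^ Suc l) * step_gf l)) * code_gf l)"
    using has_gf_Times[OF has_gf_Times[OF has_gf_bool[of 0]
      has_gf_Times[OF has_gf_multiples[OF zero_less_Suc[of l]] has_gf_step[of l]]] has_gf_codes[of l]]
    by (elim has_gf_cong) auto
  then have 1: "has_gf ?C ?W (2 * (inverse (1 - fps_X ^ Suc l) * step_gf l) * code_gf l)"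
    by simp
  define g :: "(bool \<times> nat \<times> nat) \<times> (bool \<times> nat \<times> nat) list \<Rightarrow> marked_part list" where
    "g = (\<lambda>((f, d, j), cs). ((d + Suc j, Suc j), f) # build (d + Suc j + Suc j) cs)"
  define h :: "marked_part list \<Rightarrow> (bool \<times> nat \<times> nat) \<times> (bool \<times> nat \<times> nat) list" where
    "h = (\<lambda>ys. case ys of ((n, j), f) # zs \<Rightarrow> ((f, n - j, j - 1), unbuild (n + j) zs))"
  have 2: "bij_betw g ?C {ys. full_chain ys \<and> length ys = Suc l}"
  proof (rule bij_betw_byWitness[where f' = h])
    show "\<forall>x\<in>?C. h (g x) = x"
      using unbuild_build[of "_ + _"] by (auto simp: g_def h_def simp flip: add_Suc_right)
    show "\<forall>ys\<in>{ys. full_chain ys \<and> length ys = Suc l}. g (h ys) = ys"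
    proof clarify
      fix ys assume "full_chain ys" "length ys = Suc l"
      then obtain n j f zs where ys: "ys = ((n, j), f) # zs"
        by (metis length_Suc_conv surj_pair)
      with \<open>full_chain ys\<close> have *: "1 \<le> j" "j \<le> n" "chain_above (n + j) zs" by auto
      then have **: "n - j + j = n" "Suc (j - 1) = j" by auto
      show "g (h ys) = ys"
        using build_unbuild[OF *(3)] by (simp only: ys g_def h_def list.case prod.case **)
    qed
    show "g ` ?C \<subseteq> {ys. full_chain ys \<and> length ys = Suc l}"
    proof clarify
      fix f d j and cs :: "(bool \<times> nat \<times> nat) list"
      show "full_chain (g ((f, d, j), cs)) \<and> length (g ((f, d, j), cs)) = Suc (length cs)"
        using chain_build[of "d + Suc j + Suc j" cs] by (simp add: g_def)
    qed
    show "h ` {ys. full_chain ys \<and> length ys = Suc l} \<subseteq> ?C"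
      by (auto simp: h_def length_Suc_conv)
  qed
  show ?thesis
    by (rule has_gf_bij[OF 1 2]) (auto simp: g_def part_sum_build algebra_simps)
qed

interpretation X: qbase "fps_X :: rat fps"
  by unfold_locales simp

text \<open>The exponents 2k + 1 in the numerators of \<open>step_gf\<close> add up to r^2.\<close>

lemma code_gf_closed:
  "code_gf r = fps_X ^ (r\<^sup>2) * qp_neg fps_X r * qinv fps_X (int r) * qinv_odd fps_X r"
proof (induction r)
  case (Suc r)
  let ?u = "inverse (1 - fps_X ^ Suc r) :: rat fps"
  have "(fps_X :: rat fps) ^ ((Suc r)\<^sup>2) = fps_X ^ (2 * r + 1) * fps_X ^ (r\<^sup>2)"
    by (simp only: power_add[symmetric]) (simp add: power2_eq_square)
  moreover have "code_gf (Suc r) = code_gf r * ((1 + fps_X ^ Suc r) * (?u * step_gf r))"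
    by (simp add: code_gf_def)
  ultimately show ?case
    unfolding Suc step_gf_def by (simp only: qinv_rec qinv_odd_rec qp_neg_simps mult_ac)
qed (simp add: code_gf_def)

lemma full_chain_gf_closed:
  "has_gf {ys. full_chain ys \<and> length ys = r} part_sum
    (fps_X ^ (r\<^sup>2) * qp_m1 fps_X r * qinv fps_X (int r) * qinv_odd fps_X r)"
proof (cases r)
  case 0
  have "{ys. full_chain ys \<and> length ys = 0} = {[]}" by auto
  then show ?thesis using 0 has_gf_singleton[of "[]" part_sum] by simp
next
  case (Suc l)
  let ?u = "inverse (1 - fps_X ^ Suc l) :: rat fps"
  have "(fps_X :: rat fps) ^ ((Suc l)\<^sup>2) = fps_X ^ (2 * l + 1) * fps_X ^ (l\<^sup>2)"
    by (simp only: power_add[symmetric]) (simp add: power2_eq_square)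
  moreover have "qp_m1 fps_X (Suc l) = 2 * qp_neg (fps_X :: rat fps) l"
    using qp_m1_eq[of "fps_X :: rat fps" l] by simp
  ultimately have "2 * (?u * step_gf l) * code_gf l
      = fps_X ^ ((Suc l)\<^sup>2) * qp_m1 fps_X (Suc l) * qinv fps_X (int (Suc l)) * qinv_odd fps_X (Suc l)"
    unfolding code_gf_closed step_gf_def by (simp only: qinv_rec qinv_odd_rec mult_ac)
  then show ?thesis using full_chain_gf[of l] Suc by simp
qed

lemma chain_length: "chain_above b ys \<Longrightarrow> length ys \<le> part_sum ys"
  by (induction b ys rule: chain_above.induct) auto

lemma full_chain_length: "full_chain ys \<Longrightarrow> length ys \<le> part_sum ys"
  by (induction ys rule: full_chain.induct) (auto dest!: chain_length)

text \<open>A chain is no longer than its sum, so lengths up to \<open>N\<close> account for every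
  chain of sum \<open>m\<close>.\<close>

lemma card_full_chains:
  assumes "m \<le> N"
  shows "of_nat (card {ys. full_chain ys \<and> part_sum ys = m}) = fps_nth (\<Sum>r\<le>N.
    fps_X ^ (r\<^sup>2) * qp_m1 fps_X r * qinv fps_X (int r) * qinv_odd fps_X r :: rat fps) m"
proof -
  have "has_gf (\<Union>r\<in>{..N}. {ys. full_chain ys \<and> length ys = r}) part_sum
    (\<Sum>r\<le>N. fps_X ^ (r\<^sup>2) * qp_m1 fps_X r * qinv fps_X (int r) * qinv_odd fps_X r)"
    by (intro has_gf_UN full_chain_gf_closed) auto
  moreover have "{ys \<in> \<Union>r\<in>{..N}. {ys. full_chain ys \<and> length ys = r}. part_sum ys = m}
     = {ys. full_chain ys \<and> part_sum ys = m}"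
    using assms full_chain_length by fastforce
  ultimately show ?thesis by (simp add: has_gf_def)
qed

section \<open>From the block condition to marked chains\<close>

definition mark :: "(nat \<times> nat) set \<Rightarrow> (nat \<times> nat) list \<Rightarrow> marked_part list" where
  "mark Ov xs = map (\<lambda>p. (p, p \<in> Ov)) xs"

text \<open>The condition on neighbours that replaces the one on maximal blocks; see
  \<open>L_cond_iff\<close>.\<close>

definition admissible :: "(nat \<times> nat) set \<Rightarrow> nat \<times> nat \<Rightarrow> nat \<times> nat \<Rightarrow> bool" where
  "admissible Ov a b \<longleftrightarrow> wdiff b a \<ge> 0 \<and> (b \<in> Ov \<longrightarrow> wdiff b a \<noteq> 0)"

text \<open>The weighted difference of n'_j' over n_j is n' - j' - (n + j), and an overline raises
  its least allowed value from 0 to 1. The bound also forces j' <= n'.\<close>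

lemma chain_mark_iff:
  "chain_above (n + j) (mark Ov xs) \<longleftrightarrow>
    (\<forall>p\<in>set xs. 1 \<le> snd p \<and> snd p \<le> fst p) \<and> successively (admissible Ov) ((n, j) # xs)"
proof (induction xs arbitrary: n j)
  case (Cons x xs)
  obtain n' j' where x: "x = (n', j')" by (cases x)
  have "chain_above (n + j) (mark Ov (x # xs)) \<longleftrightarrow>
      1 \<le> j' \<and> n + j + j' + of_bool (x \<in> Ov) \<le> n' \<and> chain_above (n' + j') (mark Ov xs)"
    by (simp add: mark_def x)
  also have "n + j + j' + of_bool (x \<in> Ov) \<le> n' \<longleftrightarrow> j' \<le> n' \<and> admissible Ov (n, j) x"
    by (auto simp: admissible_def wdiff_def x)
  finally show ?case
    unfolding Cons.IH by (auto simp: x)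
qed (simp add: mark_def)

lemma full_chain_mark_iff:
  "full_chain (mark Ov xs) \<longleftrightarrow>
    (\<forall>p\<in>set xs. 1 \<le> snd p \<and> snd p \<le> fst p) \<and> successively (admissible Ov) xs"
proof (cases xs)
  case (Cons x ys)
  obtain n j where x: "x = (n, j)" by (cases x)
  have "full_chain (mark Ov xs) \<longleftrightarrow> 1 \<le> j \<and> j \<le> n \<and> chain_above (n + j) (mark Ov ys)"
    by (simp add: Cons x mark_def)
  then show ?thesis unfolding chain_mark_iff by (auto simp: Cons x)
qed (simp add: mark_def)

text \<open>\<open>Z k\<close> stands for a zero difference between positions k - 1 and k, so a
  block at positions a to b has \<open>Z\<close> on a + 1 to b only.\<close>

lemma maximal_block:
  fixes Z :: "nat \<Rightarrow> bool"
  assumes "0 < k" "k < l" "Z k"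
  obtains a b where "a < k" "k \<le> b" "b < l" "\<And>i. a < i \<Longrightarrow> i \<le> b \<Longrightarrow> Z i"
    "a = 0 \<or> \<not> Z a" "b + 1 = l \<or> \<not> Z (b + 1)"
proof -
  have "\<exists>a<k. (a = 0 \<or> \<not> Z a) \<and> (\<forall>i. a < i \<and> i \<le> k \<longrightarrow> Z i)"
    using assms(1,3)
  proof (induction k)
    case (Suc k)
    show ?case
    proof (cases "k = 0 \<or> \<not> Z k")
      case True
      then show ?thesis using Suc.prems by (intro exI[of _ k]) (auto simp: le_Suc_eq)
    next
      case False
      with Suc obtain a where "a < k" "a = 0 \<or> \<not> Z a" "\<forall>i. a < i \<and> i \<le> k \<longrightarrow> Z i" by auto
      then show ?thesis using Suc.prems by (intro exI[of _ a]) (auto simp: le_Suc_eq)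
    qed
  qed simp
  then obtain a where a: "a < k" "a = 0 \<or> \<not> Z a" "\<And>i. a < i \<Longrightarrow> i \<le> k \<Longrightarrow> Z i" by blast
  let ?P = "\<lambda>b. k \<le> b \<and> (b + 1 = l \<or> \<not> Z (b + 1))"
  define b where "b = (LEAST b. ?P b)"
  have ex: "?P (l - 1)" using assms(2) by auto
  have b: "?P b" unfolding b_def by (rule LeastI[of ?P, OF ex])
  have "b \<le> l - 1" unfolding b_def by (rule Least_le[of ?P, OF ex])
  have "Z i" if "k < i" "i \<le> b" for i
  proof -
    have "\<not> ?P (i - 1)" using that not_less_Least[of "i - 1" ?P] by (simp add: b_def)
    with that show ?thesis by auto
  qed
  with a(3) have "Z i" if "a < i" "i \<le> b" for i using that by (meson not_less)
  with that[of a b] a(1,2) b \<open>b \<le> l - 1\<close> assms(2) show ?thesis by auto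
qed

lemma wdiff_nonneg_less: "1 \<le> snd b \<Longrightarrow> wdiff b a \<ge> 0 \<Longrightarrow> a < b"
  by (cases a; cases b) (auto simp: wdiff_def)

text \<open>The non-smallest parts of a maximal block have difference 0 from their predecessors, and
  conversely \<open>maximal_block\<close> places every part with this property in such a block. So
  the block condition forbids overlining exactly these parts.\<close>

lemma L_cond_iff:
  assumes "\<forall>p\<in>set xs. 1 \<le> snd p"
  shows "L_cond xs Ov \<longleftrightarrow> successively (admissible Ov) xs"
proof
  assume L: "L_cond xs Ov"
  have nonneg: "wdiff (xs ! k) (xs ! (k - 1)) \<ge> 0" if "0 < k" "k < length xs" for k
    using L that by (simp add: L_cond_def)
  show "successively (admissible Ov) xs"
    unfolding successively_conv_nth
  proof (intro allI impI)
    fix i assume i: "Suc i < length xs"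
    have "wdiff (xs ! Suc i) (xs ! i) \<noteq> 0" if "xs ! Suc i \<in> Ov"
    proof
      assume "wdiff (xs ! Suc i) (xs ! i) = 0"
      then obtain a b where ab: "a < Suc i" "Suc i \<le> b" "b < length xs"
        "\<And>k. a < k \<Longrightarrow> k \<le> b \<Longrightarrow> wdiff (xs ! k) (xs ! (k - 1)) = 0"
        "a = 0 \<or> wdiff (xs ! a) (xs ! (a - 1)) \<noteq> 0"
        "b + 1 = length xs \<or> wdiff (xs ! (b + 1)) (xs ! (b + 1 - 1)) \<noteq> 0"
        using maximal_block[of "Suc i" "length xs" "\<lambda>k. wdiff (xs ! k) (xs ! (k - 1)) = 0"] i
        by auto
      then have "a < b \<and> b < length xs
        \<and> (\<forall>k. a < k \<and> k \<le> b \<longrightarrow> wdiff (xs ! k) (xs ! (k - 1)) = 0)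
        \<and> (a = 0 \<or> wdiff (xs ! a) (xs ! (a - 1)) \<noteq> 0)
        \<and> (b + 1 = length xs \<or> wdiff (xs ! (b + 1)) (xs ! b) \<noteq> 0)" by auto
      with L have "\<forall>k. a < k \<and> k \<le> b \<longrightarrow> \<not> overl_at xs Ov k"
        unfolding L_cond_def by blast
      with ab have "\<not> overl_at xs Ov (Suc i)" by blast
      \<comment> \<open>Since the two parts differ, \<open>overl_at\<close> reduces to membership in
        \<open>Ov\<close> here.\<close>
      moreover have "xs ! i < xs ! Suc i"
        using nonneg[of "Suc i"] i assms by (intro wdiff_nonneg_less) auto
      ultimately show False using that by (auto simp: overl_at_def)
    qed
    then show "admissible Ov (xs ! i) (xs ! Suc i)"
      using nonneg[of "Suc i"] i by (simp add: admissible_def)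
  qed
next
  assume "successively (admissible Ov) xs"
  then have adm: "admissible Ov (xs ! (k - 1)) (xs ! k)" if "0 < k" "k < length xs" for k
    using that by (cases k) (auto simp: successively_conv_nth)
  show "L_cond xs Ov"
    unfolding L_cond_def
  proof (intro conjI allI impI)
    fix k assume "0 < k \<and> k < length xs"
    then show "0 \<le> wdiff (xs ! k) (xs ! (k - 1))" using adm[of k] by (simp add: admissible_def)
  next
    fix a b k
    assume "a < b \<and> b < length xs
        \<and> (\<forall>k. a < k \<and> k \<le> b \<longrightarrow> wdiff (xs ! k) (xs ! (k - 1)) = 0)
        \<and> (a = 0 \<or> wdiff (xs ! a) (xs ! (a - 1)) \<noteq> 0)
        \<and> (b + 1 = length xs \<or> wdiff (xs ! (b + 1)) (xs ! b) \<noteq> 0)" and "a < k \<and> k \<le> b"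
    then show "\<not> overl_at xs Ov k"
      using adm[of k] by (auto simp: admissible_def overl_at_def)
  qed
qed

lemma full_chain_mark_L_cond:
  "full_chain (mark Ov xs) \<longleftrightarrow> (\<forall>p\<in>set xs. 1 \<le> snd p \<and> snd p \<le> fst p) \<and> L_cond xs Ov"
  using L_cond_iff[of xs Ov] full_chain_mark_iff[of Ov xs] by auto

lemma chain_sorted: "chain_above (n + j) ys \<Longrightarrow> sorted_wrt (<) ((n, j) # map fst ys)"
proof (induction ys arbitrary: n j)
  case (Cons y ys)
  obtain n' j' f where y: "y = ((n', j'), f)" by (cases y) auto
  from Cons.prems have "n < n'" and "chain_above (n' + j') ys" by (auto simp: y)
  moreover have "(n, j) < (n', j')" using \<open>n < n'\<close> by simp
  ultimately show ?case
    using Cons.IH[of n' j'] by (simp only: y list.map fst_conv sorted_wrt2[OF transp_on_less])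
qed simp

lemma full_chain_sorted: "full_chain ys \<Longrightarrow> sorted_wrt (<) (map fst ys)"
  by (cases ys rule: full_chain.cases) (use chain_sorted in auto)

definition overlined :: "marked_part list \<Rightarrow> (nat \<times> nat) set" where
  "overlined ys = {p. (p, True) \<in> set ys}"

lemma mark_overlined: "distinct (map fst ys) \<Longrightarrow> mark (overlined ys) (map fst ys) = ys"
  unfolding mark_def map_map
  by (intro map_idI) (auto simp: overlined_def dest: eq_key_imp_eq_value)

text \<open>Chains increase strictly, so a chain is determined by its multiset of parts and its set
  of overlined parts; sorting and marking is the inverse map.\<close>

lemma L_eq_card: "L m = card {ys. full_chain ys \<and> part_sum ys = m}"
proof -
  define g where "g ys = (mset (map fst ys), overlined ys)" for ys :: "marked_part list"
  define h :: "(nat \<times> nat) multiset \<times> (nat \<times> nat) set \<Rightarrow> marked_part list" where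
    "h = (\<lambda>(P, Ov). mark Ov (sorted_list_of_multiset P))"
  have tot: "\<Sum>\<^sub># (image_mset fst (mset xs)) = part_sum (mark Ov xs)" for xs :: "(nat \<times> nat) list" and Ov
    by (induction xs) (auto simp: mark_def)
  have fc: "sorted_list_of_multiset (mset (map fst ys)) = map fst ys"
    "mark (overlined ys) (map fst ys) = ys" if "full_chain ys" for ys
  proof -
    have s: "sorted_wrt (<) (map fst ys)" using that by (rule full_chain_sorted)
    then show "sorted_list_of_multiset (mset (map fst ys)) = map fst ys"
      by (metis sorted_list_of_multiset_mset sorted_sort_id strict_sorted_imp_sorted)
    show "mark (overlined ys) (map fst ys) = ys"
      using s strict_sorted_iff mark_overlined by blast
  qed
  have "bij_betw g {ys. full_chain ys \<and> part_sum ys = m} (L_set m)"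
  proof (rule bij_betw_byWitness[where f' = h])
    show "\<forall>ys\<in>{ys. full_chain ys \<and> part_sum ys = m}. h (g ys) = ys"
      using fc by (auto simp: g_def h_def)
    show "\<forall>x\<in>L_set m. g (h x) = x"
    proof clarify
      fix P Ov assume "(P, Ov) \<in> L_set m"
      then have Ov: "Ov \<subseteq> set_mset P" by (simp add: L_set_def)
      have "map fst (mark Ov xs) = xs" for xs by (simp add: mark_def comp_def)
      moreover have "overlined (mark Ov (sorted_list_of_multiset P)) = Ov"
        using Ov by (auto simp: overlined_def mark_def)
      ultimately show "g (h (P, Ov)) = (P, Ov)" by (simp add: g_def h_def)
    qed
    show "g ` {ys. full_chain ys \<and> part_sum ys = m} \<subseteq> L_set m"
    proof (rule image_subsetI)
      fix ys assume "ys \<in> {ys. full_chain ys \<and> part_sum ys = m}"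
      then have ys: "full_chain ys" "part_sum ys = m" by auto
      have "(\<forall>p\<in>set (map fst ys). 1 \<le> snd p \<and> snd p \<le> fst p) \<and> L_cond (map fst ys) (overlined ys)"
        using ys(1) full_chain_mark_L_cond[of "overlined ys" "map fst ys"] unfolding fc(2)[OF ys(1)] by blast
      moreover have "overlined ys \<subseteq> set (map fst ys)" by (force simp: overlined_def)
      moreover have "\<Sum>\<^sub># (image_mset fst (mset (map fst ys))) = part_sum ys"
        using tot[of "map fst ys" "overlined ys"] fc(2)[OF ys(1)] by simp
      ultimately show "g ys \<in> L_set m"
        using fc(1)[OF ys(1)] ys(2) by (simp add: g_def L_set_def)
    qed
    show "h ` L_set m \<subseteq> {ys. full_chain ys \<and> part_sum ys = m}"
    proof clarify
      fix P Ov assume PO: "(P, Ov) \<in> L_set m"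
      then have "full_chain (h (P, Ov))"
        by (simp add: h_def full_chain_mark_L_cond L_set_def)
      moreover have "part_sum (h (P, Ov)) = m"
        using PO tot[of "sorted_list_of_multiset P" Ov] by (simp add: h_def L_set_def)
      ultimately show "full_chain (h (P, Ov)) \<and> part_sum (h (P, Ov)) = m" ..
    qed
  qed
  then show ?thesis by (simp add: L_def bij_betw_same_card)
qed

section \<open>Comparison of the two generating functions\<close>

lemma qinv_eq_prod: "qinv q (int n) = (\<Prod>i=1..n. inverse (1 - q ^ i))"
  unfolding qinv_def by (simp, induction n) (simp_all add: fps_inverse_mult)

theorem theorem30:
  fixes m :: nat
  assumes "1 \<le> m"
  shows "J m = L m"
proof -
  interpret Y: qbase "fps_X ^ 3 :: rat fps"
    by unfold_locales (simp add: fps_X_power_nth)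
  define Q :: "nat \<Rightarrow> rat fps" where "Q i = (1 + fps_X ^ i) * inverse (1 - fps_X ^ i)" for i
  \<comment> \<open>With this cut-off the multiples of 3 in range are 3i for 1 <= i <= m, so
    \<open>?D\<close> is exactly the product of length \<open>m\<close> in base
    \<open>fps_X ^ 3\<close> that inverts the theta series.\<close>
  let ?N = "3 * m"
  let ?F = "\<Prod>i | i \<in> {1..?N} \<and> \<not> 3 dvd i. Q i"
  let ?D = "\<Prod>i=1..m. Q (3 * i)"
  let ?S = "\<Sum>r\<le>?N. fps_X ^ (r\<^sup>2) * qp_m1 fps_X r * qinv fps_X (int r) * qinv_odd fps_X r :: rat fps"
  let ?T = "theta (fps_X ^ 3) ?N :: rat fps"
  have "qp_neg fps_X ?N * qinv fps_X (int ?N) = (\<Prod>i\<in>{1..?N}. Q i)"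
    unfolding qp_neg_def qinv_eq_prod Q_def prod.distrib ..
  also have "{1..?N} = {i. i \<in> {1..?N} \<and> \<not> 3 dvd i} \<union> {i. i \<in> {1..?N} \<and> 3 dvd i}" by auto
  also have "(\<Prod>i\<in>\<dots>. Q i) = ?F * (\<Prod>i | i \<in> {1..?N} \<and> 3 dvd i. Q i)"
    by (rule prod.union_disjoint) auto
  also have "(\<Prod>i | i \<in> {1..?N} \<and> 3 dvd i. Q i) = ?D"
    by (rule prod.reindex_bij_witness[of _ "\<lambda>i. 3 * i" "\<lambda>i. i div 3"]) auto
  finally have 1: "fps_X ^ Suc ?N dvd ?S - ?F * ?D * ?T"
    using X.slater_sum[of ?N] by simp
  have D: "qp_neg (fps_X ^ 3) m * qinv (fps_X ^ 3) (int m) = ?D"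
    unfolding qp_neg_def qinv_eq_prod Q_def prod.distrib power_mult ..
  have "(fps_X ^ 3) ^ Suc m dvd 1 - ?D * ?T"
    using Y.gauss_theta[of m ?N] unfolding D by simp
  moreover have "(fps_X :: rat fps) ^ Suc ?N dvd (fps_X ^ 3) ^ Suc m"
    unfolding power_mult[symmetric] by (rule le_imp_power_dvd) simp
  ultimately have "fps_X ^ Suc ?N dvd 1 - ?D * ?T" by (rule dvd_trans[rotated])
  \<comment> \<open>Modulo \<open>fps_X ^ Suc ?N\<close>, \<open>?S\<close> is
    \<open>?F * ?D * ?T\<close> and \<open>?D * ?T\<close> is 1.\<close>
  then have "fps_X ^ Suc ?N dvd (?S - ?F * ?D * ?T) - ?F * (1 - ?D * ?T)"
    by (rule dvd_diff[OF 1 dvd_mult])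
  then have "fps_X ^ Suc ?N dvd ?S - ?F" by (simp add: algebra_simps del: power_Suc)
  then obtain R where "?S - ?F = fps_X ^ Suc ?N * R" by (elim dvdE)
  then have "fps_nth (?S - ?F) m = 0" by (simp add: fps_X_power_mult_nth del: power_Suc)
  then have "(of_nat (J m) :: rat) = of_nat (L m)"
    using J_eq_coeff[of m ?N] card_full_chains[of m ?N] by (simp add: L_eq_card Q_def)
  then show ?thesis by simp
qed

end
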